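(* Under logit demand, for every fixed $\lambda\in(0,1)$ and all $p\in\mathbb R$, $$\frac{\partial D(\lambda,p)}{\partial p}=\frac d\zeta\{b_H(\lambda,p)-b_L(\lambda,p)\}\{b_H(\lambda,p)+b_L(\lambda,p)-1\}.$$ Consequently, the continuous-price extension $p\mapsto D(\lambda,p)$, $p\in\mathbb R$, is strictly single-peaked (strictly increasing up to its maximizer and strictly decreasing afterwards), with unconstrained maximizer $$p_D(\lambda)=\frac v2\{\pi_H(\lambda)+\pi_L(\lambda)\}.$$ A price cut always raises demand (the purchase probabilities $b_H,b_L$ are strictly decreasing in $p$) but can lower the effect of quality on the probability of a sale (there are prices $p'<p$ with $D(\lambda,p')<D(\lambda,p)$).
   Context: Let $v>0$, $\zeta>0$, $q\in(1/2,1)$, $d=2q-1$. For $\lambda\in[0,1]$ (expected current quality), $$\pi_H(\lambda)=\frac{q\lambda}{(1-q)+d\lambda},\qquad \pi_L(\lambda)=\frac{(1-q)\lambda}{q-d\lambda}$$ are the posteriors of high quality after a favorable/unfavorable signal of precision $q$. Logit demand: the purchase probability given signal $s\in\{H,L\}$ at price $p$ is $b_s(\lambda,p)=\Lambda\big((v\pi_s(\lambda)-p)/\zeta\big)$ with $\Lambda(z)=e^z/(1+e^z)$. Conditional on actual high/low quality the purchase probabilities are $A_H=qb_H+(1-q)b_L$ and $A_L=(1-q)b_H+qb_L$, and $D(\lambda,p)=A_H-A_L=d\{b_H(\lambda,p)-b_L(\lambda,p)\}$ is the effect of quality on the probability of a sale. *)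

theory Defs
  imports Complex_Main
begin

text \<open>
  \<^term>\<open>v\<close> is the value of quality, \<^term>\<open>\<zeta>\<close> the logit scale, \<^term>\<open>q\<close> the signal precision,
  \<^term>\<open>l\<close> the expected current quality (a probability of high quality) and \<^term>\<open>p\<close> the price.
\<close>

text \<open>Used both for the realised signal (favorable/unfavorable) and for actual quality.\<close>
datatype level = High | Low

definition logistic :: "real \<Rightarrow> real" where
  "logistic z = exp z / (1 + exp z)"

definition signal_gap :: "real \<Rightarrow> real" where
  "signal_gap q = 2 * q - 1"

text \<open>Posterior probability of high quality after a signal of precision \<^term>\<open>q\<close>.\<close>
fun posterior :: "level \<Rightarrow> real \<Rightarrow> real \<Rightarrow> real" where
  "posterior High q l = q * l / ((1 - q) + signal_gap q * l)"
| "posterior Low q l = (1 - q) * l / (q - signal_gap q * l)"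

text \<open>Logit purchase probability given the signal.\<close>
definition purchase_prob :: "level \<Rightarrow> real \<Rightarrow> real \<Rightarrow> real \<Rightarrow> real \<Rightarrow> real \<Rightarrow> real" where
  "purchase_prob s v \<zeta> q l p = logistic ((v * posterior s q l - p) / \<zeta>)"

text \<open>
  Purchase probability conditional on actual quality: the signal agrees with actual quality
  with probability \<^term>\<open>q\<close>.
\<close>
fun sale_prob :: "level \<Rightarrow> real \<Rightarrow> real \<Rightarrow> real \<Rightarrow> real \<Rightarrow> real \<Rightarrow> real" where
  "sale_prob High v \<zeta> q l p =
     q * purchase_prob High v \<zeta> q l p + (1 - q) * purchase_prob Low v \<zeta> q l p"
| "sale_prob Low v \<zeta> q l p =
     (1 - q) * purchase_prob High v \<zeta> q l p + q * purchase_prob Low v \<zeta> q l p"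

definition quality_effect :: "real \<Rightarrow> real \<Rightarrow> real \<Rightarrow> real \<Rightarrow> real \<Rightarrow> real" where
  "quality_effect v \<zeta> q l p = sale_prob High v \<zeta> q l p - sale_prob Low v \<zeta> q l p"

definition peak_price :: "real \<Rightarrow> real \<Rightarrow> real \<Rightarrow> real" where
  "peak_price v q l = v / 2 * (posterior High q l + posterior Low q l)"

end

theory Submission
  imports Defs
begin

text \<open>
  The logistic derivative is \<open>\<Lambda>' = \<Lambda> (1 - \<Lambda>)\<close>, so the price derivative of \<open>b\<^sub>H - b\<^sub>L\<close> factors
  as \<open>(b\<^sub>H - b\<^sub>L) (b\<^sub>H + b\<^sub>L - 1) / \<zeta>\<close>. The first factor is positive because the favorable posterior
  is the larger one; by the symmetry \<open>\<Lambda> (- z) = 1 - \<Lambda> z\<close> the second has the sign of the sum of the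
  two logit arguments, which vanishes exactly at the midpoint price.
\<close>

lemma logistic_uminus: "logistic (- z) = 1 - logistic z"
proof -
  have "1 + exp z > 0" by (simp add: add_pos_pos)
  then show ?thesis
    by (simp add: logistic_def exp_minus field_simps)
qed

lemma DERIV_logistic:
  "(logistic has_real_derivative logistic z * (1 - logistic z)) (at z)"
proof -
  have pos: "1 + exp z > 0" by (simp add: add_pos_pos)
  have "((\<lambda>z. exp z / (1 + exp z)) has_real_derivative
          (exp z * (1 + exp z) - exp z * exp z) / ((1 + exp z) * (1 + exp z))) (at z)"
    using pos by (auto intro!: derivative_eq_intros)
  moreover have "(exp z * (1 + exp z) - exp z * exp z) / ((1 + exp z) * (1 + exp z))
      = logistic z * (1 - logistic z)"
    using pos by (simp add: logistic_def field_simps)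
  ultimately show ?thesis
    by (simp add: logistic_def[abs_def])
qed

lemma strict_mono_logistic: "strict_mono logistic"
proof (rule strict_monoI)
  fix x y :: real
  assume "x < y"
  have "logistic z * (1 - logistic z) > 0" for z
    by (simp add: logistic_def field_simps add_pos_pos)
  then show "logistic x < logistic y"
    using DERIV_pos_imp_increasing[OF \<open>x < y\<close>] DERIV_logistic by blast
qed

text \<open>Since \<open>1 - logistic y\<close> is \<open>logistic (- y)\<close>, the left side
  compares values of \<open>logistic\<close> at \<open>- y\<close> and \<open>x\<close>, and strict
  monotonicity transfers this to the arguments.\<close>

lemma logistic_add_gt_1_iff: "logistic x + logistic y > 1 \<longleftrightarrow> x + y > 0"
  using strict_mono_less[OF strict_mono_logistic, of "- y" x] by (auto simp: logistic_uminus)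

lemma logistic_add_lt_1_iff: "logistic x + logistic y < 1 \<longleftrightarrow> x + y < 0"
  using strict_mono_less[OF strict_mono_logistic, of x "- y"] by (auto simp: logistic_uminus)

text \<open>Cross-multiplying and cancelling \<open>l > 0\<close> leaves two expressions whose
  difference is \<open>d * (1 - l)\<close> with \<open>d = 2 * q - 1\<close>; it is positive because
  the signal is informative and \<open>l < 1\<close>.\<close>

lemma posterior_Low_less_High:
  assumes "1 / 2 < q" "q < 1" "0 < l" "l < 1"
  shows "posterior Low q l < posterior High q l"
proof -
  define d where "d = signal_gap q"
  have d: "d = 2 * q - 1" "0 < d"
    using assms by (simp_all add: d_def signal_gap_def)
  have dl: "0 < d * l" "d * l < d"
    using assms d by auto
  \<comment> \<open>The second denominator exceeds \<open>q - d\<close>, which equals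
    \<open>1 - q\<close>.\<close>
  have "0 < (1 - q) + d * l" "0 < q - d * l"
    using dl d assms by linarith+
  moreover have "(1 - q) * ((1 - q) + d * l) < q * (q - d * l)"
  proof -
    have "q * (q - d * l) - (1 - q) * ((1 - q) + d * l) = (2 * q - 1) - d * l"
      by (simp add: algebra_simps)
    then show ?thesis using dl(2) d(1) by linarith
  qed
  then have "l * ((1 - q) * ((1 - q) + d * l)) < l * (q * (q - d * l))"
    using assms by simp
  then have "(1 - q) * l * ((1 - q) + d * l) < q * l * (q - d * l)"
    by (simp only: mult_ac)
  ultimately have "(1 - q) * l / (q - d * l) < q * l / ((1 - q) + d * l)"
    by (simp add: divide_less_eq less_divide_eq)
  then show ?thesis by (simp add: d_def)
qed

lemma purchase_prob_strict_antimono: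
  assumes "\<zeta> > 0"
  shows "strict_antimono_on UNIV (purchase_prob s v \<zeta> q l)"
  using assms
  by (auto intro!: monotone_onI strict_monoD[OF strict_mono_logistic] divide_strict_right_mono
      simp: purchase_prob_def)

lemma purchase_prob_Low_less_High:
  assumes "v > 0" "\<zeta> > 0" "1 / 2 < q" "q < 1" "0 < l" "l < 1"
  shows "purchase_prob Low v \<zeta> q l p < purchase_prob High v \<zeta> q l p"
  unfolding purchase_prob_def
  using assms posterior_Low_less_High[OF assms(3-6)]
  by (intro strict_monoD[OF strict_mono_logistic] divide_strict_right_mono diff_strict_right_mono
      mult_strict_left_mono)

text \<open>The peak price is the midpoint of the two expected valuations, so for
  \<open>\<zeta> > 0\<close> the sum of the logit arguments is positive below it and negative above
  it.\<close>

lemma purchase_prob_arguments_sum: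
  "(v * posterior High q l - p) / \<zeta> + (v * posterior Low q l - p) / \<zeta> = 2 * (peak_price v q l - p) / \<zeta>"
  by (simp add: peak_price_def add_divide_distrib[symmetric] algebra_simps del: posterior.simps)

lemma purchase_prob_sum_gt_1_iff:
  assumes "\<zeta> > 0"
  shows "purchase_prob High v \<zeta> q l p + purchase_prob Low v \<zeta> q l p > 1 \<longleftrightarrow> p < peak_price v q l"
  unfolding purchase_prob_def logistic_add_gt_1_iff purchase_prob_arguments_sum
  using assms by (simp add: zero_less_divide_iff)

lemma purchase_prob_sum_lt_1_iff:
  assumes "\<zeta> > 0"
  shows "purchase_prob High v \<zeta> q l p + purchase_prob Low v \<zeta> q l p < 1 \<longleftrightarrow> peak_price v q l < p"
  unfolding purchase_prob_def logistic_add_lt_1_iff purchase_prob_arguments_sum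
  using assms by (simp add: divide_less_0_iff)

lemma DERIV_purchase_prob:
  assumes "\<zeta> \<noteq> 0"
  shows "(purchase_prob s v \<zeta> q l has_real_derivative
           - (purchase_prob s v \<zeta> q l p * (1 - purchase_prob s v \<zeta> q l p)) / \<zeta>) (at p)"
proof -
  have "((\<lambda>p. (v * posterior s q l - p) / \<zeta>) has_real_derivative - 1 / \<zeta>) (at p)"
    using assms by (auto intro!: derivative_eq_intros)
  from DERIV_chain2[OF DERIV_logistic this] show ?thesis
    by (simp add: purchase_prob_def[abs_def])
qed

lemma quality_effect_eq:
  "quality_effect v \<zeta> q l p
    = signal_gap q * (purchase_prob High v \<zeta> q l p - purchase_prob Low v \<zeta> q l p)"
  by (simp add: quality_effect_def signal_gap_def algebra_simps)

lemma DERIV_quality_effect: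
  assumes "\<zeta> \<noteq> 0"
  shows "(quality_effect v \<zeta> q l has_real_derivative
           signal_gap q / \<zeta>
             * (purchase_prob High v \<zeta> q l p - purchase_prob Low v \<zeta> q l p)
             * (purchase_prob High v \<zeta> q l p + purchase_prob Low v \<zeta> q l p - 1)) (at p)"
  unfolding quality_effect_eq[abs_def]
  using assms
  by (auto intro!: derivative_eq_intros DERIV_purchase_prob simp: field_simps)

theorem proposition1:
  fixes v \<zeta> q l :: real
  assumes "v > 0" and "\<zeta> > 0" and "1 / 2 < q" and "q < 1" and "0 < l" and "l < 1"
  shows
    "(\<forall>p. ((\<lambda>x. quality_effect v \<zeta> q l x) has_real_derivative
            signal_gap q / \<zeta>
              * (purchase_prob High v \<zeta> q l p - purchase_prob Low v \<zeta> q l p)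
              * (purchase_prob High v \<zeta> q l p + purchase_prob Low v \<zeta> q l p - 1)) (at p))
     \<and> (\<forall>m. is_arg_max (quality_effect v \<zeta> q l) (\<lambda>_. True) m \<longleftrightarrow> m = peak_price v q l)
     \<and> strict_mono_on {..peak_price v q l} (quality_effect v \<zeta> q l)
     \<and> strict_antimono_on {peak_price v q l..} (quality_effect v \<zeta> q l)
     \<and> (\<forall>s. strict_antimono_on UNIV (purchase_prob s v \<zeta> q l))
     \<and> (\<exists>p' p. p' < p \<and> quality_effect v \<zeta> q l p' < quality_effect v \<zeta> q l p)"
proof -
  let ?D = "quality_effect v \<zeta> q l" and ?P = "peak_price v q l"
  define D' where "D' p = signal_gap q / \<zeta>
      * (purchase_prob High v \<zeta> q l p - purchase_prob Low v \<zeta> q l p)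
      * (purchase_prob High v \<zeta> q l p + purchase_prob Low v \<zeta> q l p - 1)" for p
  have deriv: "(?D has_real_derivative D' p) (at p)" for p
    unfolding D'_def using assms(2) by (intro DERIV_quality_effect) simp
  \<comment> \<open>The derivative vanishes at \<open>?P\<close>, so its strict sign is available
    only on open intervals ending there; continuity extends strict monotonicity to the
    endpoint.\<close>
  then have cont: "continuous_on A ?D" for A
    by (meson DERIV_continuous_on has_field_derivative_at_within)
  \<comment> \<open>This factor is positive at every price, so the sign of \<open>D'\<close> is that
    of the remaining factor.\<close>
  have gap: "signal_gap q / \<zeta> * (purchase_prob High v \<zeta> q l p - purchase_prob Low v \<zeta> q l p) > 0"
    for p
    using purchase_prob_Low_less_High[OF assms] assms by (simp add: signal_gap_def)
  have D'_pos: "D' p > 0" if "p < ?P" for p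
    unfolding D'_def
    using purchase_prob_sum_gt_1_iff[OF assms(2), of v q l p] that
    by (intro mult_pos_pos[OF gap]) simp
  have D'_neg: "D' p < 0" if "?P < p" for p
    unfolding D'_def
    using purchase_prob_sum_lt_1_iff[OF assms(2), of v q l p] that
    by (intro mult_pos_neg[OF gap]) simp
  have incr: "?D x < ?D y" if "x < y" "y \<le> ?P" for x y
    using that by (intro DERIV_pos_imp_increasing_open[OF _ _ cont]) (auto intro!: exI deriv D'_pos)
  have decr: "?D y < ?D x" if "x < y" "?P \<le> x" for x y
    using that by (intro DERIV_neg_imp_decreasing_open[OF _ _ cont]) (auto intro!: exI deriv D'_neg)
  \<comment> \<open>Strictness against every other price yields both that \<open>?P\<close> is a
    maximizer and that it is the only one.\<close>
  have peak: "?D m < ?D ?P" if "m \<noteq> ?P" for m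
    using incr[of m ?P] decr[of ?P m] that by fastforce
  have "is_arg_max ?D (\<lambda>_. True) m \<longleftrightarrow> m = ?P" for m
    using peak by (metis is_arg_max_def order_less_asym)
  \<comment> \<open>A price cut starting from the peak lowers the quality effect; the size 1 of the
    cut is arbitrary.\<close>
  moreover have "?D (?P - 1) < ?D ?P"
    by (rule incr) simp_all
  then have "\<exists>p' p. p' < p \<and> ?D p' < ?D p"
    by (meson diff_less_eq less_add_one)
  moreover have "strict_mono_on {..?P} ?D" "strict_antimono_on {?P..} ?D"
    by (simp_all add: monotone_on_def incr decr)
  ultimately show ?thesis
    using deriv purchase_prob_strict_antimono[OF assms(2)] unfolding D'_def by blast
qed

end
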